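(* Let $A_1,\ldots,A_n:\mathcal H\rightrightarrows\mathcal H$ be maximally monotone operators on a real Hilbert space $\mathcal H$ with $\operatorname{zer}(\sum_{i=1}^nA_i)\neq\emptyset$, let $G=(\mathcal N,\mathcal E)$ be an algorithmic graph of order $n\ge 2$, $G'=(\mathcal N,\mathcal E')$ a connected spanning subgraph of $G$, and $Z\in\mathbb R^{n\times(n-1)}$ with $\operatorname{Lap}(G')=ZZ^*$. Let $\widetilde{\mathcal T}=\mathcal C^*(\mathcal M+\mathcal A)^{-1}\mathcal C:\mathcal H^{n-1}\to\mathcal H^{n-1}$, with $\mathcal M,\mathcal C,\mathcal A$ as defined in the context. Then, for any $\boldsymbol v\in\mathcal H^{n-1}$, $$\widetilde{\mathcal T}(\boldsymbol v)=\boldsymbol v-Z_\otimes^*\boldsymbol x,\quad\text{where}\quad x_i=J_{\frac1{d_i}A_i}\bigg(\frac1{d_i}(Z_\otimes\boldsymbol v)_i+\frac2{d_i}\sum_{(h,i)\in\mathcal E}x_h\bigg),\quad i=1,\ldots,n.$$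
   Context: $\mathcal H^m$ carries the inner product $\langle\boldsymbol x,\boldsymbol y\rangle=\sum_i\langle x_i,y_i\rangle$. For set-valued $A$: $\operatorname{zer}A=\{x\mid0\in A(x)\}$ and $J_A=(\mathrm{Id}+A)^{-1}$ is the resolvent. Graphs: an algorithmic graph of order $n\ge2$ is a directed graph $G=(\mathcal N,\mathcal E)$ with $\mathcal N=\{1,\ldots,n\}$, $\mathcal E\subseteq\mathcal N\times\mathcal N$, $(i,j)\in\mathcal E\Rightarrow i<j$, and $G$ connected (ignoring edge directions). $G'=(\mathcal N,\mathcal E')$ is a spanning subgraph of $G$ if $\mathcal E'\subseteq\mathcal E$. The degree $d_i$ is the number of edges of $G$ entering or leaving node $i$. The Laplacian of a graph is the $n\times n$ matrix with the degrees of that graph on the diagonal, $-1$ in entry $(i,j)$ if $i,j$ are adjacent (i.e. $(i,j)$ or $(j,i)$ is an edge), and $0$ otherwise. Notation: for $K\in\mathbb R^{m\times p}$, $K_\otimes:\mathcal H^p\to\mathcal H^m$, $(K_\otimes\boldsymbol x)_i=\sum_jK_{i,j}x_j$; $Z_\otimes^*=(Z^* )_\otimes$. Operators: $\mathcal A_D(\boldsymbol x)=A_1(x_1)\times\cdots\times A_n(x_n)$ for $\boldsymbol x\in\mathcal H^n$. $P(G)\in\mathbb R^{n\times n}$ has entries $P(G)_{i,i}=d_i$, $P(G)_{i,j}=-2$ if $(j,i)\in\mathcal E$, and $0$ otherwise. On $\mathcal H^{2n-1}=\mathcal H^n\times\mathcal H^{n-1}$, $$\mathcal M=\begin{bmatrix}\operatorname{Lap}(G')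 & Z \\ Z^* & I_{n-1}\end{bmatrix}_\otimes,\quad \mathcal C=\begin{bmatrix} Z \\ I_{n-1}\end{bmatrix}_\otimes:\mathcal H^{n-1}\to\mathcal H^{2n-1},\quad \mathcal A=\begin{bmatrix}\mathcal A_D+P(G)_\otimes-\operatorname{Lap}(G')_\otimes & -Z_\otimes \\ Z^*_\otimes & 0\end{bmatrix},$$ and $(\mathcal M+\mathcal A)^{-1}$ is the inverse as a set-valued operator. *)

theory Defs
  imports "HOL-Analysis.Analysis"
begin

text \<open>
  The index set \<open>{1, \<dots>, n}\<close> is modelled by a finite linearly ordered type \<open>'n\<close>, so
  \<open>n = CARD('n)\<close>, and the space \<open>H^m\<close> by \<open>'h ^ 'm\<close>; the library inner products on
  \<open>'h ^ 'm\<close> and on the product type are the componentwise sums.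
  Set-valued operators are functions \<open>'a \<Rightarrow> 'b set\<close>, and \<open>+\<close> on sets is
  the Minkowski sum of \<open>HOL-Library.Set_Algebras\<close>.
\<close>

definition monotone_operator :: "('a::real_inner \<Rightarrow> 'a set) \<Rightarrow> bool" where
  "monotone_operator A \<longleftrightarrow> (\<forall>x y. \<forall>u \<in> A x. \<forall>v \<in> A y. (x - y) \<bullet> (u - v) \<ge> 0)"

definition maximally_monotone :: "('a::real_inner \<Rightarrow> 'a set) \<Rightarrow> bool" where
  "maximally_monotone A \<longleftrightarrow>
     monotone_operator A \<and> (\<forall>B. monotone_operator B \<longrightarrow> (\<forall>x. A x \<subseteq> B x) \<longrightarrow> B = A)"

definition zer :: "('a \<Rightarrow> 'b::zero set) \<Rightarrow> 'a set" where
  "zer A = {x. 0 \<in> A x}"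

definition inverse_operator :: "('a \<Rightarrow> 'b set) \<Rightarrow> 'b \<Rightarrow> 'a set" where
  "inverse_operator A u = {x. u \<in> A x}"

definition resolvent :: "('a::real_vector \<Rightarrow> 'a set) \<Rightarrow> 'a \<Rightarrow> 'a set" where
  "resolvent A = inverse_operator (\<lambda>x. {x} + A x)"

definition scale_operator :: "real \<Rightarrow> ('a \<Rightarrow> 'b::real_vector set) \<Rightarrow> 'a \<Rightarrow> 'b set" where
  "scale_operator c A x = (\<lambda>u. c *\<^sub>R u) ` A x"

text \<open>A graph is given by its edge set; the node set is the whole type.\<close>

definition connected_graph :: "('n \<times> 'n) set \<Rightarrow> bool" where
  "connected_graph E \<longleftrightarrow> (\<forall>i j. (i, j) \<in> (E \<union> E\<inverse>)\<^sup>*)"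

definition algorithmic_graph :: "('n::{finite,linorder} \<times> 'n) set \<Rightarrow> bool" where
  "algorithmic_graph E \<longleftrightarrow>
     CARD('n) \<ge> 2 \<and> (\<forall>i j. (i, j) \<in> E \<longrightarrow> i < j) \<and> connected_graph E"

definition degree :: "('n::finite \<times> 'n) set \<Rightarrow> 'n \<Rightarrow> nat" where
  "degree E i = card {e \<in> E. fst e = i \<or> snd e = i}"

definition Lap :: "('n::finite \<times> 'n) set \<Rightarrow> real ^ 'n ^ 'n" where
  "Lap E = (\<chi> i j. if i = j then real (degree E i)
                   else if (i, j) \<in> E \<or> (j, i) \<in> E then - 1 else 0)"

definition P_matrix :: "('n::finite \<times> 'n) set \<Rightarrow> real ^ 'n ^ 'n" where
  "P_matrix E = (\<chi> i j. if i = j then real (degree E i)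
                        else if (j, i) \<in> E then - 2 else 0)"

text \<open>The operator \<open>K\<^sub>\<otimes>\<close> induced by a real matrix \<open>K\<close>.\<close>

definition tensor :: "real ^ 'p ^ 'm \<Rightarrow> 'h::real_vector ^ 'p \<Rightarrow> 'h ^ 'm" where
  "tensor K x = (\<chi> i. \<Sum>j\<in>UNIV. (K $ i $ j) *\<^sub>R (x $ j))"

definition diag_operator :: "('n \<Rightarrow> 'h \<Rightarrow> 'h set) \<Rightarrow> 'h ^ 'n \<Rightarrow> ('h ^ 'n) set" where
  "diag_operator A x = {u. \<forall>i. u $ i \<in> A i (x $ i)}"

text \<open>
  \<open>H^(2n-1)\<close> is \<open>('h ^ 'n) \<times> ('h ^ 'm)\<close> with \<open>CARD('m) = n - 1\<close>, and
  block matrices act blockwise.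
\<close>

definition M_operator ::
  "('n::finite \<times> 'n) set \<Rightarrow> real ^ 'm ^ 'n \<Rightarrow>
   ('h::real_vector ^ 'n) \<times> ('h ^ 'm) \<Rightarrow> ('h ^ 'n) \<times> ('h ^ 'm)" where
  "M_operator E' Z = (\<lambda>(x, y).
     (tensor (Lap E') x + tensor Z y,
      tensor (transpose Z) x + tensor (mat 1) y))"

definition C_operator ::
  "real ^ 'm ^ 'n \<Rightarrow> 'h::real_vector ^ 'm \<Rightarrow> ('h ^ 'n) \<times> ('h ^ 'm)" where
  "C_operator Z y = (tensor Z y, tensor (mat 1) y)"

definition A_operator ::
  "('n::finite \<Rightarrow> 'h \<Rightarrow> 'h set) \<Rightarrow> ('n \<times> 'n) set \<Rightarrow> ('n \<times> 'n) set \<Rightarrow> real ^ 'm ^ 'n \<Rightarrow>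
   ('h::real_vector ^ 'n) \<times> ('h ^ 'm) \<Rightarrow> (('h ^ 'n) \<times> ('h ^ 'm)) set" where
  "A_operator A E E' Z = (\<lambda>(x, y).
     (diag_operator A x + {tensor (P_matrix E) x - tensor (Lap E') x - tensor Z y})
     \<times> {tensor (transpose Z) x})"

text \<open>
  The reduced operator is a priori set-valued; \<open>adjoint\<close> is the Hilbert space adjoint
  for the inner products above.
\<close>

definition T_tilde ::
  "('n::finite \<Rightarrow> 'h \<Rightarrow> 'h set) \<Rightarrow> ('n \<times> 'n) set \<Rightarrow> ('n \<times> 'n) set \<Rightarrow> real ^ 'm ^ 'n \<Rightarrow>
   'h::real_inner ^ 'm \<Rightarrow> ('h ^ 'm) set" where
  "T_tilde A E E' Z v =
     adjoint (C_operator Z) `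
       inverse_operator (\<lambda>z. {M_operator E' Z z} + A_operator A E E' Z z) (C_operator Z v)"

end

theory Submission
  imports Defs
begin

text \<open>
  The point of the proposition is that the block system \<open>\<C> v \<in> (\<M> + \<A>) (x, y)\<close> is triangular.
  In the first row the terms \<open>Lap E'\<close> and \<open>Z y\<close> of \<open>\<M>\<close> cancel against those of \<open>\<A>\<close>, leaving
  \<open>Z v \<in> A_D x + P x\<close>, which no longer involves \<open>y\<close>; the second row then gives
  \<open>y = v - 2 Z\<^sup>* x\<close>. As \<open>P\<close> has the degrees on its diagonal and its other nonzero entries
  come from the edges entering a node, the \<open>i\<close>-th row of the first equation, divided by \<open>d\<^sub>i\<close>,
  is exactly the resolvent equation for \<open>x\<^sub>i\<close> in terms of the \<open>x\<^sub>h\<close> with \<open>(h, i) \<in> E\<close>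
  (\<open>mem_inverse_M_plus_A_iff\<close>, \<open>mem_scaled_resolvent_iff_inclusion\<close>). Finally
  \<open>\<C>\<^sup>* (x, y) = Z\<^sup>* x + y = v - Z\<^sup>* x\<close>.

  Such an \<open>x\<close> exists and is unique by recursion along the edges, which form a well-founded
  relation, provided that each resolvent is single-valued with full domain. Full domain is
  Minty's theorem in Hilbert space. It is proved here through the Fitzpatrick function
  \<open>F (x, u) = sup {x \<bullet> v + y \<bullet> u - y \<bullet> v | v \<in> A y}\<close>: this is a closed convex function, maximality
  of \<open>A\<close> gives \<open>F (x, u) \<ge> x \<bullet> u\<close>, and so \<open>F p + (p \<bullet> p) / 2\<close> is bounded below by \<open>0\<close>. By strong
  convexity and completeness it has a minimiser, and the optimality condition there exhibits a
  point of the graph of \<open>A\<close> of the form \<open>(x, - x)\<close>, that is, a zero of \<open>Id + A\<close>. Scaling and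
  translating \<open>A\<close> turns this single zero into surjectivity of \<open>Id + c A\<close>.
\<close>

section \<open>Minimising a quadratically perturbed convex function\<close>

text \<open>
  For \<open>S\<close> the epigraph of a closed convex \<open>F\<close>, this says that \<open>F q + (q \<bullet> q) / 2\<close> has a
  minimiser \<open>p\<close>, where \<open>- p\<close> is a subgradient of \<open>F\<close>. Working with the epigraph avoids functions
  with infinite values. A minimising sequence is Cauchy because, by the parallelogram law, the
  midpoint of two almost minimal points would otherwise lie below the infimum; completeness then
  stands in for compactness. The subgradient inequality is the first-order condition along
  the segment from the minimiser to any other point of \<open>S\<close>.
\<close>

lemma quadratic_epigraph_minimiser:
  fixes S :: "('a::{real_inner,complete_space} \<times> real) set"
  assumes ne: "S \<noteq> {}" and cl: "closed S" and cv: "convex S"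
    and bdd: "\<And>p t. (p, t) \<in> S \<Longrightarrow> b \<le> t + (p \<bullet> p) / 2"
  obtains p t where "(p, t) \<in> S"
    and "\<And>q s. (q, s) \<in> S \<Longrightarrow> t - p \<bullet> (q - p) \<le> s"
proof -
  define g :: "'a \<times> real \<Rightarrow> real" where "g = (\<lambda>(p, t). t + (p \<bullet> p) / 2)"
  define m where "m = Inf (g ` S)"
  have bb: "bdd_below (g ` S)"
    using bdd by (intro bdd_belowI[of _ b]) (auto simp: g_def)
  have m_le: "m \<le> g z" if "z \<in> S" for z
    unfolding m_def using bb that by (intro cInf_lower) auto
  have "\<exists>z. z \<in> S \<and> g z < m + 1 / real (Suc n)" for n
  proof -
    have "Inf (g ` S) < m + 1 / real (Suc n)"
      by (simp add: m_def)
    then show ?thesis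
      using ne bb by (auto simp: cInf_less_iff)
  qed
  then obtain z where zS: "\<And>n. z n \<in> S" and zg: "\<And>n. g (z n) < m + 1 / real (Suc n)"
    by metis
  define p where "p n = fst (z n)" for n
  define t where "t n = snd (z n)" for n
  have z_eq: "z n = (p n, t n)" for n by (simp add: p_def t_def)
  \<comment> \<open>Parallelogram law, applied to the midpoint of \<open>z j\<close> and \<open>z k\<close>, at which \<open>g\<close> is at least \<open>m\<close>.\<close>
  have par: "(dist (p j) (p k))\<^sup>2 \<le> 4 * (1 / real (Suc j) + 1 / real (Suc k))" for j k
  proof -
    have "(1/2) *\<^sub>R z j + (1/2) *\<^sub>R z k \<in> S"
      using cv zS by (intro convexD) auto
    from m_le[OF this]
    have "m \<le> (t j + t k) / 2
        + (((1/2) *\<^sub>R p j + (1/2) *\<^sub>R p k) \<bullet> ((1/2) *\<^sub>R p j + (1/2) *\<^sub>R p k)) / 2"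
      by (simp add: g_def z_eq add_divide_distrib)
    then have "(dist (p j) (p k))\<^sup>2 \<le> 4 * ((g (z j) - m) + (g (z k) - m))"
      by (simp add: g_def z_eq dist_norm power2_norm_eq_inner inner_commute algebra_simps add_divide_distrib)
    also have "\<dots> \<le> 4 * (1 / real (Suc j) + 1 / real (Suc k))"
      using zg[of j] zg[of k] by (intro mult_left_mono add_mono) auto
    finally show ?thesis .
  qed
  have "Cauchy p"
  proof (rule metric_CauchyI)
    fix e :: real assume e: "e > 0"
    obtain N where N: "8 / e\<^sup>2 < real N" using reals_Archimedean2 by blast
    have small: "1 / real (Suc k) < e\<^sup>2 / 8" if "k \<ge> N" for k
    proof -
      have "8 / e\<^sup>2 < real (Suc k)" using N that by linarith
      with e show ?thesis by (simp add: field_simps)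
    qed
    have "dist (p j) (p k) < e" if "j \<ge> N" "k \<ge> N" for j k
    proof -
      have "(dist (p j) (p k))\<^sup>2 < e\<^sup>2"
        using par[of j k] add_strict_mono[OF small[OF that(1)] small[OF that(2)]] by argo
      then show ?thesis using e by (simp add: power_less_imp_less_base)
    qed
    then show "\<exists>N. \<forall>j\<ge>N. \<forall>k\<ge>N. dist (p j) (p k) < e" by blast
  qed
  then obtain q where q: "p \<longlonglongrightarrow> q"
    using Cauchy_convergent_iff convergent_def by blast
  \<comment> \<open>Since \<open>g (z n)\<close> and \<open>p n\<close> converge, so does the height \<open>t n\<close>, and closedness of \<open>S\<close> applies.\<close>
  have "(\<lambda>n. g (z n)) \<longlonglongrightarrow> m"
  proof (rule tendsto_sandwich[OF _ _ tendsto_const])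
    show "\<forall>\<^sub>F n in sequentially. m \<le> g (z n)" using m_le zS by simp
    show "\<forall>\<^sub>F n in sequentially. g (z n) \<le> m + 1 / real (Suc n)"
      using zg by (simp add: less_imp_le)
    show "(\<lambda>n. m + 1 / real (Suc n)) \<longlonglongrightarrow> m"
      using tendsto_add[OF tendsto_const LIMSEQ_inverse_real_of_nat, of m]
      by (simp add: inverse_eq_divide)
  qed
  then have "(\<lambda>n. g (z n) - (p n \<bullet> p n) / 2) \<longlonglongrightarrow> m - (q \<bullet> q) / 2"
    by (intro tendsto_intros q) auto
  then have t: "t \<longlonglongrightarrow> m - (q \<bullet> q) / 2"
    by (simp add: g_def z_eq)
  have "z \<longlonglongrightarrow> (q, m - (q \<bullet> q) / 2)"
    using tendsto_Pair[OF q t] by (simp add: z_eq[abs_def])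
  with cl zS have limS: "(q, m - (q \<bullet> q) / 2) \<in> S"
    using closed_sequentially by blast
  moreover
  have "m - (q \<bullet> q) / 2 - q \<bullet> (r - q) \<le> s" if rs: "(r, s) \<in> S" for r s
  proof -
    \<comment> \<open>Up to the quadratic remainder, \<open>\<delta>\<close> is the slope of \<open>g\<close> from the minimiser towards \<open>(r, s)\<close>.\<close>
    define \<delta> where "\<delta> = s - (m - (q \<bullet> q) / 2) + q \<bullet> (r - q)"
    have "- (a * ((r - q) \<bullet> (r - q)) / 2) \<le> \<delta>" if a: "0 < a" "a < 1" for a
    proof -
      have "(1 - a) *\<^sub>R (q, m - (q \<bullet> q) / 2) + a *\<^sub>R (r, s) \<in> S"
        using cv limS rs a by (intro convexD) auto
      from m_le[OF this]
      have "0 \<le> a * (\<delta> + a * ((r - q) \<bullet> (r - q)) / 2)"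
        by (simp add: g_def \<delta>_def inner_commute algebra_simps add_divide_distrib diff_divide_distrib)
      then have "0 \<le> \<delta> + a * ((r - q) \<bullet> (r - q)) / 2"
        using a(1) by (simp add: zero_le_mult_iff)
      then show ?thesis by linarith
    qed
    then have ev: "\<forall>\<^sub>F a in at_right (0::real). - (a * ((r - q) \<bullet> (r - q)) / 2) \<le> \<delta>"
      by (intro eventually_at_rightI[of 0 1]) auto
    have "((\<lambda>a. - (a * ((r - q) \<bullet> (r - q)) / 2)) \<longlongrightarrow> - (0 * ((r - q) \<bullet> (r - q)) / 2)) (at_right (0::real))"
      by (intro tendsto_intros) auto
    from tendsto_upperbound[OF this ev] have "0 \<le> \<delta>" by simp
    then show ?thesis by (simp add: \<delta>_def)
  qed
  ultimately show thesis using that by blast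
qed

section \<open>Minty's theorem\<close>

text \<open>
  Maximality in its pointwise form: a pair monotonically related to the whole graph could be
  added to the graph, so it already belongs to it.
\<close>

lemma maximally_monotone_memI:
  assumes "maximally_monotone A"
    and rel: "\<And>y v. v \<in> A y \<Longrightarrow> (x - y) \<bullet> (u - v) \<ge> 0"
  shows "u \<in> A x"
proof -
  define B where "B = A(x := insert u (A x))"
  have mono: "monotone_operator A"
    and max: "\<And>B. monotone_operator B \<Longrightarrow> (\<forall>x. A x \<subseteq> B x) \<Longrightarrow> B = A"
    using assms(1) by (auto simp: maximally_monotone_def)
  have rel': "(y - x) \<bullet> (v - u) \<ge> 0" if "v \<in> A y" for y v
    using rel[OF that] by (simp add: inner_diff_left inner_diff_right)
  have "monotone_operator B"
    using mono rel rel'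
    unfolding monotone_operator_def B_def by (auto split: if_splits)
  then have "B = A" by (rule max) (auto simp: B_def)
  then show ?thesis by (metis B_def fun_upd_same insertI1)
qed

lemma maximally_monotone_nonempty:
  assumes "maximally_monotone A"
  obtains y v where "v \<in> A y"
  using maximally_monotone_memI[OF assms, of 0 0] by blast

text \<open>
  The translation by \<open>z\<close> reduces solving \<open>z \<in> x + c A x\<close> to finding a zero of \<open>Id + B\<close> for another
  maximally monotone \<open>B\<close>.
\<close>

lemma maximally_monotone_affine:
  assumes A: "maximally_monotone A" and c: "c > 0"
  shows "maximally_monotone (\<lambda>x. (\<lambda>u. c *\<^sub>R u - z) ` A x)"
  unfolding maximally_monotone_def
proof (intro conjI allI impI)
  have mono: "(x - y) \<bullet> (u - v) \<ge> 0" if "u \<in> A x" "v \<in> A y" for x y u v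
    using A that by (auto simp: maximally_monotone_def monotone_operator_def)
  have scale: "(c *\<^sub>R u - z) - (c *\<^sub>R v - z) = c *\<^sub>R (u - v)" for u v
    by (simp add: scaleR_diff_right)
  show "monotone_operator (\<lambda>x. (\<lambda>u. c *\<^sub>R u - z) ` A x)"
    unfolding monotone_operator_def using mono c by (auto simp only: scale inner_scaleR_right image_iff zero_le_mult_iff)
  fix B assume B: "monotone_operator B" and sub: "\<forall>x. (\<lambda>u. c *\<^sub>R u - z) ` A x \<subseteq> B x"
  have "w \<in> (\<lambda>u. c *\<^sub>R u - z) ` A x" if w: "w \<in> B x" for w x
  proof -
    define u where "u = (1 / c) *\<^sub>R (w + z)"
    have w_eq: "w = c *\<^sub>R u - z" using c by (simp add: u_def)
    have "u \<in> A x"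
    proof (rule maximally_monotone_memI[OF A])
      fix y v assume "v \<in> A y"
      then have "c *\<^sub>R v - z \<in> B y" using sub by auto
      with B w have "(x - y) \<bullet> (w - (c *\<^sub>R v - z)) \<ge> 0"
        by (auto simp: monotone_operator_def)
      then show "(x - y) \<bullet> (u - v) \<ge> 0"
        using c by (simp only: w_eq scale inner_scaleR_right zero_le_mult_iff) auto
    qed
    then show ?thesis using w_eq by blast
  qed
  with sub show "B = (\<lambda>x. (\<lambda>u. c *\<^sub>R u - z) ` A x)" by (intro ext) blast
qed

text \<open>
  This is \<open>0 \<in> ran (Id + A)\<close>, the core of Minty's theorem. The set \<open>S\<close> in the proof is the epigraph
  of the Fitzpatrick function of \<open>A\<close>. The graph points \<open>((y, v), y \<bullet> v)\<close> lie in \<open>S\<close> by monotonicity,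
  and \<open>x \<bullet> u \<le> t\<close> on \<open>S\<close> by maximality. Inserting the graph points into the optimality condition at
  the minimiser \<open>(x, u)\<close> shows that \<open>(- u, - x)\<close> is monotonically related to the graph, hence in
  it; inserting this very point then forces \<open>x + u = 0\<close>.
\<close>

lemma maximally_monotone_antifixed_point:
  fixes A :: "'a::{real_inner,complete_space} \<Rightarrow> 'a set"
  assumes A: "maximally_monotone A"
  obtains x where "- x \<in> A x"
proof -
  define S where "S = (\<Inter>(y, v) \<in> {(y, v). v \<in> A y}.
     {((x, u), t). x \<bullet> v + y \<bullet> u - y \<bullet> v \<le> t})"
  have S_iff: "((x, u), t) \<in> S \<longleftrightarrow> (\<forall>y v. v \<in> A y \<longrightarrow> x \<bullet> v + y \<bullet> u - y \<bullet> v \<le> t)" for x u t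
    by (auto simp: S_def)
  have mono: "(x - y) \<bullet> (u - v) \<ge> 0" if "u \<in> A x" "v \<in> A y" for x y u v
    using A that by (auto simp: maximally_monotone_def monotone_operator_def)
  have graph: "((y, v), y \<bullet> v) \<in> S" if "v \<in> A y" for y v
    unfolding S_iff using mono[OF that]
    by (simp add: inner_diff_left inner_diff_right algebra_simps)
  have above: "x \<bullet> u \<le> t" if "((x, u), t) \<in> S" for x u t
  proof (rule ccontr)
    assume neg: "\<not> x \<bullet> u \<le> t"
    have "(x - y) \<bullet> (u - v) \<ge> 0" if "v \<in> A y" for y v
    proof -
      have "x \<bullet> v + y \<bullet> u - y \<bullet> v \<le> t" using \<open>((x, u), t) \<in> S\<close> that S_iff by blast
      with neg show ?thesis by (simp add: inner_diff_left inner_diff_right)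
    qed
    then have "u \<in> A x" by (rule maximally_monotone_memI[OF A])
    with \<open>((x, u), t) \<in> S\<close> neg show False by (force simp: S_iff)
  qed
  have ne: "S \<noteq> {}"
    using maximally_monotone_nonempty[OF A] graph by (metis empty_iff)
  have cl: "closed S"
    unfolding S_def case_prod_unfold
    by (intro closed_INT ballI closed_Collect_le continuous_intros)
  have cv: "convex S"
  proof -
    have "convex {((x, u), t::real). x \<bullet> v + y \<bullet> u - y \<bullet> v \<le> t}" for y v :: 'a
    proof -
      have "{((x, u), t::real). x \<bullet> v + y \<bullet> u - y \<bullet> v \<le> t} = {z. ((v, y), -1) \<bullet> z \<le> y \<bullet> v}"
        by (auto simp: inner_commute)
      then show ?thesis by (simp only: convex_halfspace_le)
    qed
    then show ?thesis unfolding S_def by (intro convex_INT) auto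
  qed
  have bdd: "0 \<le> t + (p \<bullet> p) / 2" if pt: "(p, t) \<in> S" for p t
  proof -
    obtain x u where p: "p = (x, u)" by fastforce
    have "0 \<le> ((x + u) \<bullet> (x + u)) / 2" by simp
    also have "\<dots> = x \<bullet> u + (p \<bullet> p) / 2"
      by (simp add: p inner_add_left inner_add_right inner_commute)
    finally show ?thesis using above pt p by fastforce
  qed
  obtain p t where ptS: "(p, t) \<in> S"
    and sub: "\<And>q s. (q, s) \<in> S \<Longrightarrow> t - p \<bullet> (q - p) \<le> s"
    using quadratic_epigraph_minimiser[OF ne cl cv bdd] by blast
  obtain x u where p: "p = (x, u)" by fastforce
  \<comment> \<open>The optimality condition at a graph point, rearranged using \<open>x \<bullet> u \<le> t\<close>.\<close>
  have key: "(x + u) \<bullet> (x + u) \<le> (- u - y) \<bullet> (- x - v)" if "v \<in> A y" for y v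
    using sub[OF graph[OF that]] above[of x u t] ptS
    by (simp add: p inner_add_left inner_add_right inner_diff_left inner_diff_right inner_commute)
  have "- x \<in> A (- u)"
  proof (rule maximally_monotone_memI[OF A])
    fix y v assume "v \<in> A y"
    then show "0 \<le> (- u - y) \<bullet> (- x - v)"
      using key order_trans[OF inner_ge_zero] by blast
  qed
  moreover from key[OF this] have "x = - u"
    by (metis add.inverse_inverse diff_minus_eq_add diff_self eq_neg_iff_add_eq_0 inner_gt_zero_iff inner_zero_left not_le)
  ultimately show thesis using that by metis
qed

lemma mem_resolvent_scale_iff:
  "x \<in> resolvent (scale_operator c A) z \<longleftrightarrow> (\<exists>u\<in>A x. z = x + c *\<^sub>R u)"
  by (auto simp: resolvent_def inverse_operator_def scale_operator_def set_plus_def)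

lemma resolvent_singleton:
  fixes A :: "'a::{real_inner,complete_space} \<Rightarrow> 'a set"
  assumes A: "maximally_monotone A" and c: "c > 0"
  obtains x where "resolvent (scale_operator c A) z = {x}"
proof -
  obtain x where "- x \<in> (\<lambda>u. c *\<^sub>R u - z) ` A x"
    using maximally_monotone_antifixed_point[OF maximally_monotone_affine[OF A c]] by blast
  then obtain u where u: "u \<in> A x" and z: "z = x + c *\<^sub>R u"
    by (auto simp: algebra_simps)
  have "y = x" if y: "y \<in> resolvent (scale_operator c A) z" for y
  proof -
    obtain w where w: "w \<in> A y" and z': "z = y + c *\<^sub>R w"
      using y by (auto simp: mem_resolvent_scale_iff)
    have diff: "y - x = - c *\<^sub>R (w - u)" using z z' by (simp add: algebra_simps)
    have "0 \<le> (y - x) \<bullet> (w - u)"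
      using A u w by (auto simp: maximally_monotone_def monotone_operator_def)
    then have "c * ((w - u) \<bullet> (w - u)) \<le> 0" by (simp add: diff)
    then have "(w - u) \<bullet> (w - u) \<le> 0" using c by (simp add: mult_le_0_iff)
    then have "w = u" by (metis inner_gt_zero_iff not_le right_minus_eq)
    then show ?thesis using diff by simp
  qed
  moreover have "x \<in> resolvent (scale_operator c A) z"
    using u z by (auto simp: mem_resolvent_scale_iff)
  ultimately show thesis using that by blast
qed

section \<open>Solving the equations along the graph\<close>

text \<open>
  With \<open>R\<close> the edge relation, admissibility says that the equation at a node involves only the
  values at the tails of the edges entering it.
\<close>

lemma wf_unique_fixpoint:
  assumes wf: "wf R" and adm: "adm_wf R F"
  shows "\<exists>!x. \<forall>i. x i = F x i"
proof (rule ex1I)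
  show "\<forall>i. wfrec R F i = F (wfrec R F) i"
    using wfrec_fixpoint[OF wf adm] by metis
  fix x assume x: "\<forall>i. x i = F x i"
  show "x = wfrec R F"
  proof
    fix i show "x i = wfrec R F i"
      using wf
    proof (induction i rule: wf_induct_rule)
      case (less i)
      then have "F x i = F (wfrec R F) i" using adm by (simp add: adm_wf_def)
      then show ?case using x wfrec_fixpoint[OF wf adm] by metis
    qed
  qed
qed

lemma algorithmic_graph_wf:
  assumes "algorithmic_graph E"
  shows "wf E"
proof (rule finite_acyclic_wf)
  show "finite E" by simp
  have "i < j" if "(i, j) \<in> E\<^sup>+" for i j
    using that
  proof (induction rule: trancl_induct)
    case (base k)
    then show ?case using assms by (simp add: algorithmic_graph_def)
  next
    case (step j k)
    then have "j < k" using assms by (simp add: algorithmic_graph_def)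
    with step.IH show ?case by (rule less_trans)
  qed
  then show "acyclic E" by (auto simp: acyclic_def)
qed

text \<open>
  Connectedness and \<open>n \<ge> 2\<close> enter here: a path from \<open>i\<close> to a different node has a first edge.
  This makes the step sizes \<open>1 / d\<^sub>i\<close> of the resolvents positive.
\<close>

lemma algorithmic_graph_degree_pos:
  assumes "algorithmic_graph E"
  shows "degree E i > 0"
proof -
  have "\<exists>j. j \<noteq> i"
  proof (rule ccontr)
    assume "\<nexists>j. j \<noteq> i"
    then have "UNIV = {i}" by blast
    then have "CARD('a) = 1" by (metis card.empty card.insert empty_iff finite.emptyI One_nat_def)
    then show False using assms by (simp add: algorithmic_graph_def)
  qed
  then obtain j where "j \<noteq> i" by blast
  moreover have "(i, j) \<in> (E \<union> E\<inverse>)\<^sup>*"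
    using assms by (simp add: algorithmic_graph_def connected_graph_def)
  ultimately obtain k where "(i, k) \<in> E \<union> E\<inverse>" by (metis converse_rtranclE)
  then have "{e \<in> E. fst e = i \<or> snd e = i} \<noteq> {}" by force
  then show ?thesis unfolding degree_def by (simp add: card_gt_0_iff)
qed

section \<open>The reduced operator\<close>

lemma tensor_mat_1: "tensor (mat 1) x = x"
  by (simp add: tensor_def mat_def vec_eq_iff if_distrib[where f = "\<lambda>c. c *\<^sub>R _"] cong: if_cong)

lemma inner_tensor:
  fixes Z :: "real ^ 'm ^ 'n" and x :: "'h::real_inner ^ 'n"
  shows "tensor Z y \<bullet> x = y \<bullet> tensor (transpose Z) x"
proof -
  have "tensor Z y \<bullet> x = (\<Sum>i\<in>UNIV. \<Sum>j\<in>UNIV. Z $ i $ j * (y $ j \<bullet> x $ i))"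
    by (simp add: inner_vec_def tensor_def inner_sum_left)
  also have "\<dots> = (\<Sum>j\<in>UNIV. \<Sum>i\<in>UNIV. Z $ i $ j * (y $ j \<bullet> x $ i))"
    by (rule sum.swap)
  also have "\<dots> = y \<bullet> tensor (transpose Z) x"
    by (simp add: inner_vec_def tensor_def transpose_def inner_sum_right)
  finally show ?thesis .
qed

lemma adjoint_C_operator:
  fixes Z :: "real ^ 'm ^ 'n"
  shows "adjoint (C_operator Z :: 'h::real_inner ^ 'm \<Rightarrow> _)
    = (\<lambda>(x, y). tensor (transpose Z) x + y)"
  by (rule adjoint_unique)
    (auto simp: C_operator_def tensor_mat_1 inner_tensor inner_add_right)

text \<open>
  Without loops, the diagonal entry \<open>d\<^sub>i\<close> does not interfere with the entries \<open>- 2\<close>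
  contributed by the edges entering \<open>i\<close>.
\<close>

lemma tensor_P_matrix:
  assumes irrefl: "(i, i) \<notin> E"
  shows "tensor (P_matrix E) x $ i
    = real (degree E i) *\<^sub>R (x $ i) - 2 *\<^sub>R (\<Sum>h | (h, i) \<in> E. x $ h)"
proof -
  have "tensor (P_matrix E) x $ i
      = (\<Sum>j\<in>UNIV. (if j = i then real (degree E i) *\<^sub>R (x $ i) else 0)
          - (if (j, i) \<in> E then 2 *\<^sub>R (x $ j) else 0))"
    using irrefl by (auto simp: tensor_def P_matrix_def intro!: sum.cong)
  also have "\<dots> = real (degree E i) *\<^sub>R (x $ i) - (\<Sum>j | (j, i) \<in> E. 2 *\<^sub>R (x $ j))"
    by (simp add: sum_subtractf sum.If_cases)
  finally show ?thesis by (simp add: scaleR_sum_right)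
qed

text \<open>
  Elimination in the block system: the remaining terms of \<open>\<A>\<close> are chosen so that \<open>y\<close> and \<open>Lap E'\<close>
  drop out of the first row, and both copies of \<open>Z\<^sup>*\<close> add up in the second.
\<close>

lemma mem_inverse_M_plus_A_iff:
  "(x, y) \<in> inverse_operator (\<lambda>z. {M_operator E' Z z} + A_operator A E E' Z z) (C_operator Z v)
    \<longleftrightarrow> (\<forall>i. tensor Z v $ i - tensor (P_matrix E) x $ i \<in> A i (x $ i))
      \<and> y = v - 2 *\<^sub>R tensor (transpose Z) x"
proof -
  let ?x = "tensor (transpose Z) x"
  have "(x, y) \<in> inverse_operator (\<lambda>z. {M_operator E' Z z} + A_operator A E E' Z z) (C_operator Z v)
    \<longleftrightarrow> (\<exists>a\<in>diag_operator A x.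
          tensor Z v = tensor (Lap E') x + tensor Z y
            + (a + (tensor (P_matrix E) x - tensor (Lap E') x - tensor Z y))
          \<and> v = ?x + y + ?x)"
    by (auto simp: inverse_operator_def set_plus_def M_operator_def A_operator_def C_operator_def
        tensor_mat_1)
  also have "\<dots> \<longleftrightarrow> tensor Z v - tensor (P_matrix E) x \<in> diag_operator A x
      \<and> y = v - 2 *\<^sub>R ?x"
  proof -
    have "v = ?x + y + ?x \<longleftrightarrow> y = v - 2 *\<^sub>R ?x"
      by (auto simp: scaleR_2)
    moreover have "l + z + (a + (p - l - z)) = a + p" for l z a p :: "'a ^ 'b"
      by simp
    ultimately show ?thesis by (simp add: eq_diff_eq Bex_def) (metis add_diff_cancel diff_add_cancel)
  qed
  finally show ?thesis by (simp add: diag_operator_def)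
qed

lemma mem_scaled_resolvent_iff_inclusion:
  assumes "d > 0"
  shows "x \<in> resolvent (scale_operator (1 / d) A) ((1 / d) *\<^sub>R w + (2 / d) *\<^sub>R s)
    \<longleftrightarrow> w - (d *\<^sub>R x - 2 *\<^sub>R s) \<in> A x"
proof -
  have "(1 / d) *\<^sub>R w + (2 / d) *\<^sub>R s = x + (1 / d) *\<^sub>R u
      \<longleftrightarrow> u = w - (d *\<^sub>R x - 2 *\<^sub>R s)" for u
  proof -
    have "(1 / d) *\<^sub>R w + (2 / d) *\<^sub>R s = x + (1 / d) *\<^sub>R u
        \<longleftrightarrow> d *\<^sub>R ((1 / d) *\<^sub>R w + (2 / d) *\<^sub>R s) = d *\<^sub>R (x + (1 / d) *\<^sub>R u)"
      using assms by simp
    also have "\<dots> \<longleftrightarrow> w + 2 *\<^sub>R s = d *\<^sub>R x + u"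
      using assms by (simp add: scaleR_add_right)
    also have "\<dots> \<longleftrightarrow> u = w - (d *\<^sub>R x - 2 *\<^sub>R s)"
      by (auto simp: algebra_simps)
    finally show ?thesis .
  qed
  then show ?thesis by (auto simp: mem_resolvent_scale_iff)
qed

theorem proposition3p5:
  fixes A :: "'n::{finite,linorder} \<Rightarrow> 'h::{real_inner,complete_space} \<Rightarrow> 'h set"
    and E E' :: "('n \<times> 'n) set"
    and Z :: "real ^ ('m::finite) ^ 'n::{finite,linorder}"
    and v :: "'h ^ 'm"
  assumes "\<And>i. maximally_monotone (A i)"
    and "zer (\<lambda>x. \<Sum>i\<in>UNIV. A i x) \<noteq> {}"
    and "CARD('m) = CARD('n) - 1"
    and "algorithmic_graph E"
    and "E' \<subseteq> E" and "connected_graph E'"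
    and "Lap E' = Z ** transpose Z"
  shows "(\<exists>!x :: 'h ^ 'n::{finite,linorder}.
           \<forall>i. resolvent (scale_operator (1 / real (degree E i)) (A i))
                 ((1 / real (degree E i)) *\<^sub>R (tensor Z v $ i)
                  + (2 / real (degree E i)) *\<^sub>R (\<Sum>h | (h, i) \<in> E. x $ h)) = {x $ i})
       \<and> (\<forall>x :: 'h ^ 'n::{finite,linorder}.
           (\<forall>i. resolvent (scale_operator (1 / real (degree E i)) (A i))
                 ((1 / real (degree E i)) *\<^sub>R (tensor Z v $ i)
                  + (2 / real (degree E i)) *\<^sub>R (\<Sum>h | (h, i) \<in> E. x $ h)) = {x $ i})
           \<longrightarrow> T_tilde A E E' Z v = {v - tensor (transpose Z) x})"
proof -
  have deg: "real (degree E i) > 0" for i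
    using algorithmic_graph_degree_pos[OF assms(4)] by simp
  have irrefl: "(i, i) \<notin> E" for i
    using assms(4) by (auto simp: algorithmic_graph_def)
  define R where "R i w = resolvent (scale_operator (1 / real (degree E i)) (A i)) w" for i w
  define arg where "arg x i = (1 / real (degree E i)) *\<^sub>R (tensor Z v $ i)
      + (2 / real (degree E i)) *\<^sub>R (\<Sum>h | (h, i) \<in> E. x h)" for x :: "'n \<Rightarrow> 'h" and i
  have R_single: "\<exists>p. R i w = {p}" for i w
  proof -
    have "1 / real (degree E i) > 0" using deg by simp
    from resolvent_singleton[OF assms(1) this] show ?thesis unfolding R_def by blast
  qed
  define J where "J i w = the_elem (R i w)" for i w
  have R_eq: "R i w = {J i w}" for i w
    using R_single[of i w] by (metis J_def the_elem_eq)
  have incl: "tensor Z v $ i - tensor (P_matrix E) x $ i \<in> A i (x $ i)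
      \<longleftrightarrow> x $ i = J i (arg (($) x) i)" for x i
  proof -
    have "tensor Z v $ i - tensor (P_matrix E) x $ i \<in> A i (x $ i)
        \<longleftrightarrow> x $ i \<in> R i (arg (($) x) i)"
      unfolding R_def arg_def tensor_P_matrix[OF irrefl]
      by (rule mem_scaled_resolvent_iff_inclusion[OF deg, symmetric])
    then show ?thesis by (simp add: R_eq)
  qed
  have arg_cong_E: "J i (arg f i) = J i (arg g i)" if "\<forall>h. (h, i) \<in> E \<longrightarrow> f h = g h" for f g i
  proof -
    have "(\<Sum>h | (h, i) \<in> E. f h) = (\<Sum>h | (h, i) \<in> E. g h)"
      using that by (intro sum.cong) auto
    then show ?thesis by (simp add: arg_def)
  qed
  have "\<exists>!f. \<forall>i. f i = J i (arg f i)"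
    by (rule wf_unique_fixpoint[OF algorithmic_graph_wf[OF assms(4)]])
      (auto simp: adm_wf_def intro: arg_cong_E)
  then obtain f where f: "\<And>i. f i = J i (arg f i)"
    and f_unique: "\<And>g. \<forall>i. g i = J i (arg g i) \<Longrightarrow> g = f"
    by metis
  have sol_iff: "(\<forall>i. x $ i = J i (arg (($) x) i)) \<longleftrightarrow> x = (\<chi> i. f i)"
    for x :: "'h ^ 'n::{finite,linorder}"
  proof -
    have "(\<forall>i. x $ i = J i (arg (($) x) i)) \<longleftrightarrow> ($) x = f"
      using f f_unique by metis
    then show ?thesis by (auto simp: vec_eq_iff)
  qed
  have T: "T_tilde A E E' Z v = {v - tensor (transpose Z) (\<chi> i. f i)}"
  proof -
    have "inverse_operator (\<lambda>z. {M_operator E' Z z} + A_operator A E E' Z z) (C_operator Z v)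
        = {((\<chi> i. f i), v - 2 *\<^sub>R tensor (transpose Z) (\<chi> i. f i))}"
      unfolding set_eq_iff split_paired_All mem_inverse_M_plus_A_iff incl sol_iff by auto
    then show ?thesis
      by (simp add: T_tilde_def adjoint_C_operator scaleR_2)
  qed
  have "(\<forall>i. R i (arg (($) x) i) = {x $ i}) \<longleftrightarrow> x = (\<chi> i. f i)" for x
  proof -
    have "(\<forall>i. R i (arg (($) x) i) = {x $ i}) \<longleftrightarrow> (\<forall>i. x $ i = J i (arg (($) x) i))"
      unfolding R_eq by (metis singleton_inject)
    then show ?thesis by (simp only: sol_iff)
  qed
  then show ?thesis
    unfolding R_def arg_def by (simp only: T simp_thms ex1_eq)
qed

end
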